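(* Consider a chores Fisher market with $n$ agents, $m$ divisible chores, disutilities $d_{ij}>0$ and earning requirements $B_i>0$. Let $\epsilon\in(0,1)$, let $(\beta^t,p^t)_{t\ge0}$ be generated by the greedy Frank-Wolfe (GFW) algorithm from a starting point $(\beta^0,p^0)\in Y$, and for $t\ge1$ let $x^t$ be the optimal dual variable at iteration $t$. Let $f(\beta)=-\sum_i B_i\log\beta_i$ and let $f(\beta^* )$ be the maximum of $f$ over $Y$. Let $T\ge1$ be an integer with $$T\ge\frac{2.3\,\big(f(\beta^* )-f(\beta^0)\big)}{\epsilon^2\,\min_i B_i}.$$ Then there exists $t\le T$ ($t\ge1$) such that $(p^t,x^t)$ is an $\epsilon$-approximate competitive equilibrium.
   Context: Notation: $[k]=\{1,\dots,k\}$, $\langle\cdot,\cdot\rangle$ is the Euclidean inner product, $d_i=(d_{i1},\dots,d_{im})$, $x_i=(x_{i1},\dots,x_{im})$. $\epsilon$-approximate competitive equilibrium ($\epsilon$-CE): a pair $(p,x)$ with $p\in\mathbb{R}^m_{\ge0}$, $x\in\mathbb{R}^{n\times m}_{\ge0}$ such that (1) $(1-\epsilon)B_i\le\langle p,x_i\rangle\le\frac1{1-\epsilon}B_i$ for all $i\in[n]$; (2) for all $i\in[n]$, $(1-\epsilon)\langle d_i,x_i\rangle\le\langle d_i,y_i\rangle$ for all $y_i\in\mathbb{R}^m_{\ge0}$ with $\langle p,y_i\rangle\ge\langle p,x_i\rangle$; (3) $1-\epsilon\le\sum_i x_{ij}\le\frac1{1-\epsilon}$ for all $j\in[m]$. Feasible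 polyhedron: $Y=\{(\beta,p)\in\mathbb{R}^{n+m}_{\ge0}:\ p_j\le\beta_i d_{ij}\ \forall i\in[n],j\in[m],\ \sum_j p_j=\sum_i B_i\}$. (Every $(\beta,p)\in Y$ has $\beta>0$.) GFW algorithm for maximizing $f$ over $Y$: starting from $(\beta^0,p^0)\in Y$, for each $t\ge1$ let $(\beta^t,p^t)$ be an optimal solution of the linear program $$\min_{(\beta,p)\in Y}\ \sum_i B_i\frac{\beta_i}{\beta_i^{t-1}}.$$ Dual variable: $x^t\in\mathbb{R}^{n\times m}_{\ge0}$ is an optimal dual variable for the constraints $p_j\le d_{ij}\beta_i$ of the $t$-th linear program, i.e. the $x$-part of an optimal solution of $\max\{\lambda\sum_i B_i:\ x\ge0,\ \lambda\in\mathbb{R},\ \sum_i x_{ij}\ge\lambda\ \forall j,\ \sum_j d_{ij}x_{ij}\le B_i/\beta_i^{t-1}\ \forall i\}$. *)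

theory Defs
  imports "HOL-Analysis.Analysis"
begin

text \<open>
  Agents are indexed by the finite type \<open>'n\<close> and chores by the finite type \<open>'m\<close>
  (types are nonempty, so there is at least one of each).  Disutilities and allocations have
  type \<^typ>\<open>real^'m^'n\<close>, so \<open>d $ i\<close> is the vector of agent \<open>i\<close> and \<open>d $ i $ j\<close> its entry
  at chore \<open>j\<close>.
\<close>

definition eps_CE ::
  "real^'m^'n \<Rightarrow> real^'n \<Rightarrow> real \<Rightarrow> real^'m \<Rightarrow> real^'m^'n \<Rightarrow> bool" where
  "eps_CE d B \<epsilon> p x \<longleftrightarrow>
     (\<forall>j. 0 \<le> p $ j) \<and> (\<forall>i j. 0 \<le> x $ i $ j) \<and>
     (\<forall>i. (1 - \<epsilon>) * B $ i \<le> p \<bullet> (x $ i) \<and> p \<bullet> (x $ i) \<le> 1 / (1 - \<epsilon>) * B $ i) \<and>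
     (\<forall>i. \<forall>y::real^'m. (\<forall>j. 0 \<le> y $ j) \<and> p \<bullet> y \<ge> p \<bullet> (x $ i) \<longrightarrow>
        (1 - \<epsilon>) * ((d $ i) \<bullet> (x $ i)) \<le> (d $ i) \<bullet> y) \<and>
     (\<forall>j. 1 - \<epsilon> \<le> (\<Sum>i\<in>UNIV. x $ i $ j) \<and> (\<Sum>i\<in>UNIV. x $ i $ j) \<le> 1 / (1 - \<epsilon>))"

definition feasible_Y :: "real^'m^'n \<Rightarrow> real^'n \<Rightarrow> ((real^'n) \<times> (real^'m)) set" where
  "feasible_Y d B =
     {(\<beta>, p). (\<forall>i. 0 \<le> \<beta> $ i) \<and> (\<forall>j. 0 \<le> p $ j) \<and>
        (\<forall>i j. p $ j \<le> \<beta> $ i * d $ i $ j) \<and>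
        (\<Sum>j\<in>UNIV. p $ j) = (\<Sum>i\<in>UNIV. B $ i)}"

definition log_obj :: "real^'n \<Rightarrow> real^'n \<Rightarrow> real" where
  "log_obj B \<beta> = - (\<Sum>i\<in>UNIV. B $ i * ln (\<beta> $ i))"

definition gfw_lp_optimal ::
  "real^'m^'n \<Rightarrow> real^'n \<Rightarrow> real^'n \<Rightarrow> (real^'n) \<times> (real^'m) \<Rightarrow> bool" where
  "gfw_lp_optimal d B \<beta>prev =
     is_arg_min (\<lambda>(\<beta>, p). \<Sum>i\<in>UNIV. B $ i * (\<beta> $ i / \<beta>prev $ i))
                (\<lambda>z. z \<in> feasible_Y d B)"

definition gfw_sequence ::
  "real^'m^'n \<Rightarrow> real^'n \<Rightarrow> (nat \<Rightarrow> real^'n) \<Rightarrow> (nat \<Rightarrow> real^'m) \<Rightarrow> bool" where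
  "gfw_sequence d B \<beta> p \<longleftrightarrow>
     (\<beta> 0, p 0) \<in> feasible_Y d B \<and>
     (\<forall>t\<ge>1. gfw_lp_optimal d B (\<beta> (t - 1)) (\<beta> t, p t))"

definition dual_feasible ::
  "real^'m^'n \<Rightarrow> real^'n \<Rightarrow> real^'n \<Rightarrow> ((real^'m^'n) \<times> real) set" where
  "dual_feasible d B \<beta>prev =
     {(x, l). (\<forall>i j. 0 \<le> x $ i $ j) \<and>
        (\<forall>j. (\<Sum>i\<in>UNIV. x $ i $ j) \<ge> l) \<and>
        (\<forall>i. (\<Sum>j\<in>UNIV. d $ i $ j * x $ i $ j) \<le> B $ i / \<beta>prev $ i)}"

text \<open>
  Only the multipliers \<open>x\<close> of the constraints \<open>p $ j \<le> d $ i $ j * \<beta> $ i\<close> are kept; the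
  multiplier \<open>l\<close> of the equality constraint is existentially quantified.
\<close>

definition optimal_dual_variable ::
  "real^'m^'n \<Rightarrow> real^'n \<Rightarrow> real^'n \<Rightarrow> real^'m^'n \<Rightarrow> bool" where
  "optimal_dual_variable d B \<beta>prev x \<longleftrightarrow>
     (\<exists>l. is_arg_max (\<lambda>(x, l). l * (\<Sum>i\<in>UNIV. B $ i))
            (\<lambda>z. z \<in> dual_feasible d B \<beta>prev) (x, l))"

end

theory Submission
  imports Defs
begin

text \<open>
  Put \<open>r\<^sub>i = \<beta>\<^sub>i\<^sup>t / \<beta>\<^sub>i\<^sup>t\<^sup>-\<^sup>1\<close>.  Complementary slackness for the \<open>t\<close>-th linear program gives
  that agent \<open>i\<close> earns \<open>r\<^sub>i B\<^sub>i\<close>, only does chores of minimal disutility per unit of payment, and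
  that every chore is allocated in the amount \<open>\<lambda> = \<Sum> r\<^sub>i B\<^sub>i / \<Sum> B\<^sub>i \<le> 1\<close>, the optimal value of the
  program.  So it suffices that all \<open>r\<^sub>i\<close> lie between \<open>1 - \<epsilon>\<close> and \<open>1 / (1 - \<epsilon>)\<close>.  As \<open>\<lambda> \<le> 1\<close>, the
  objective grows by at least \<open>\<Sum> B\<^sub>i (r\<^sub>i - 1 - ln r\<^sub>i)\<close> in step \<open>t\<close>; every summand is
  nonnegative, so some step among the first \<open>T\<close> makes all of them at most
  \<open>\<epsilon>\<^sup>2 min B / 2.3\<close>, and \<open>r - 1 - ln r > \<epsilon>\<^sup>2 / 2\<close> outside the required range.
\<close>

section \<open>Quadratic lower bounds for \<open>r - 1 - ln r\<close>\<close>

text \<open>Both sides vanish at \<open>s = 1\<close>, and right minus left has derivative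
  \<open>- (1 - u)\<^sup>2 / u\<close>, so it decreases up to 1.\<close>

lemma ln_lower_half_square_le:
  fixes s :: real
  assumes "0 < s" "s \<le> 1"
  shows "(1 - s)\<^sup>2 / 2 \<le> s - 1 - ln s"
proof -
  let ?g = "\<lambda>s::real. s - 1 - ln s - (1 - s)\<^sup>2 / 2"
  have "?g 1 \<le> ?g s"
  proof (rule DERIV_nonpos_imp_nonincreasing[OF assms(2)])
    fix u :: real assume u: "s \<le> u" "u \<le> 1"
    with assms have "0 < u" by simp
    have "(?g has_real_derivative 1 - 1 / u + (1 - u)) (at u)"
      using \<open>0 < u\<close> by (auto intro!: derivative_eq_intros simp: field_simps)
    moreover have "1 - 1 / u + (1 - u) = - ((1 - u)\<^sup>2 / u)"
      using \<open>0 < u\<close> by (simp add: field_simps power2_eq_square)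
    moreover have "0 \<le> (1 - u)\<^sup>2 / u" using \<open>0 < u\<close> by simp
    ultimately show "\<exists>y. (?g has_real_derivative y) (at u) \<and> y \<le> 0" by (intro exI conjI) auto
  qed
  then show ?thesis by simp
qed

text \<open>The right side is the gap at the ratio \<open>1 / s\<close>. With
  \<open>v = - ln s\<close> it equals \<open>exp v - 1 - v\<close>, which is at least
  \<open>v\<^sup>2 / 2\<close>, and \<open>v\<close> is at least \<open>1 - s\<close>.\<close>

lemma ln_upper_half_square_le:
  fixes s :: real
  assumes "0 < s" "s \<le> 1"
  shows "(1 - s)\<^sup>2 / 2 \<le> 1 / s - 1 + ln s"
proof -
  define v where "v = - ln s"
  have v: "0 \<le> v" using assms by (simp add: v_def)
  have s: "1 / s = exp v" using assms by (simp add: v_def exp_minus inverse_eq_divide)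
  have "1 - s \<le> v" using ln_le_minus_one[OF assms(1)] by (simp add: v_def)
  then have "(1 - s)\<^sup>2 \<le> v\<^sup>2" using assms by (intro power_mono) auto
  moreover have "1 + v + v\<^sup>2 / 2 \<le> exp v" by (rule exp_lower_Taylor_quadratic[OF v])
  ultimately show ?thesis unfolding s by (simp add: v_def)
qed

text \<open>Outside the range, \<open>1 - r\<close> or \<open>1 - 1 / r\<close> exceeds
  \<open>\<epsilon>\<close>, and the matching quadratic bound contradicts
  \<open>gap\<close>.\<close>

lemma ratio_bounds_of_log_gap:
  fixes r \<epsilon> :: real
  assumes "0 < r" "0 < \<epsilon>" "\<epsilon> < 1" and gap: "r - 1 - ln r \<le> \<epsilon>\<^sup>2 / 2"
  shows "1 - \<epsilon> \<le> r" "r \<le> 1 / (1 - \<epsilon>)"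
proof -
  show "1 - \<epsilon> \<le> r"
  proof (rule ccontr)
    assume *: "\<not> ?thesis"
    then have "\<epsilon>\<^sup>2 < (1 - r)\<^sup>2" using assms by (intro power_strict_mono) auto
    with ln_lower_half_square_le[of r] * assms show False by simp
  qed
  show "r \<le> 1 / (1 - \<epsilon>)"
  proof (rule ccontr)
    assume "\<not> ?thesis"
    then have *: "1 / r < 1 - \<epsilon>" using assms by (simp add: field_simps)
    then have "1 / r \<le> 1" using assms by linarith
    have "\<epsilon>\<^sup>2 < (1 - 1 / r)\<^sup>2" using * assms by (intro power_strict_mono) auto
    moreover have "(1 - 1 / r)\<^sup>2 / 2 \<le> r - 1 - ln r"
      using ln_upper_half_square_le[of "1 / r"] \<open>1 / r \<le> 1\<close> \<open>0 < r\<close> by (simp add: ln_div)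
    ultimately show False using gap by simp
  qed
qed

section \<open>Linear programming duality by separation\<close>

text \<open>
  If no such allocation existed, the constant vector \<open>l\<close> would be separated from the
  convex, downward closed set of column sums of allocations respecting \<open>c\<close>, and the
  normal vector, rescaled to total \<open>S\<close>, would be a price vector of cost below \<open>v\<close>.
  Only weak separation is needed because \<open>l * S < v\<close> is strict.
\<close>

lemma gfw_strong_duality:
  fixes d :: "real^'m^'n" and c :: "real^'n"
  assumes d: "\<And>i j. 0 < d $ i $ j" and c: "\<And>i. 0 < c $ i" and S: "0 < S"
    and primal: "\<And>b q. \<lbrakk>\<And>i. 0 \<le> b $ i; \<And>j. 0 \<le> q $ j; \<And>i j. q $ j \<le> b $ i * d $ i $ j;
        (\<Sum>j\<in>UNIV. q $ j) = S\<rbrakk> \<Longrightarrow> v \<le> (\<Sum>i\<in>UNIV. c $ i * b $ i)"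
    and l: "l * S < v"
  shows "\<exists>x::real^'m^'n. (\<forall>i j. 0 \<le> x $ i $ j) \<and> (\<forall>j. l \<le> (\<Sum>i\<in>UNIV. x $ i $ j)) \<and>
           (\<forall>i. (\<Sum>j\<in>UNIV. d $ i $ j * x $ i $ j) \<le> c $ i)"
proof (rule ccontr)
  assume neg: "\<not> ?thesis"
  define X :: "(real^'m^'n) set" where
    "X = {x. (\<forall>i j. 0 \<le> x $ i $ j) \<and> (\<forall>i. (\<Sum>j\<in>UNIV. d $ i $ j * x $ i $ j) \<le> c $ i)}"
  define K :: "(real^'m) set" where
    "K = {z. \<exists>x\<in>X. \<forall>j. z $ j \<le> (\<Sum>i\<in>UNIV. x $ i $ j)}"
  let ?l = "\<chi> j::'m. l"
  have X0: "0 \<in> X" using c by (simp add: X_def less_imp_le)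
  have "convex X"
  proof (rule convexI)
    fix x y :: "real^'m^'n" and u w :: real
    assume x: "x \<in> X" and y: "y \<in> X" and u: "0 \<le> u" "0 \<le> w" "u + w = 1"
    have "(\<Sum>j\<in>UNIV. d $ i $ j * (u * x $ i $ j + w * y $ i $ j)) \<le> c $ i" for i
    proof -
      have "(\<Sum>j\<in>UNIV. d $ i $ j * (u * x $ i $ j + w * y $ i $ j)) =
          u * (\<Sum>j\<in>UNIV. d $ i $ j * x $ i $ j) + w * (\<Sum>j\<in>UNIV. d $ i $ j * y $ i $ j)"
        by (simp add: sum_distrib_left sum.distrib algebra_simps)
      also have "\<dots> \<le> u * c $ i + w * c $ i"
        using x y u by (intro add_mono mult_left_mono) (auto simp: X_def)
      also have "\<dots> = c $ i" using u by (simp flip: distrib_right)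
      finally show ?thesis .
    qed
    then show "u *\<^sub>R x + w *\<^sub>R y \<in> X" using x y u by (simp add: X_def)
  qed
  have "convex K"
  proof (rule convexI)
    fix y z :: "real^'m" and u w :: real
    assume "y \<in> K" "z \<in> K" and u: "0 \<le> u" "0 \<le> w" "u + w = 1"
    then obtain x x' where x: "x \<in> X" "\<And>j. y $ j \<le> (\<Sum>i\<in>UNIV. x $ i $ j)"
      and x': "x' \<in> X" "\<And>j. z $ j \<le> (\<Sum>i\<in>UNIV. x' $ i $ j)"
      unfolding K_def by blast
    have "u * y $ j + w * z $ j \<le> (\<Sum>i\<in>UNIV. (u *\<^sub>R x + w *\<^sub>R x') $ i $ j)" for j
    proof -
      have "u * y $ j + w * z $ j \<le>
          u * (\<Sum>i\<in>UNIV. x $ i $ j) + w * (\<Sum>i\<in>UNIV. x' $ i $ j)"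
        using x x' u by (intro add_mono mult_left_mono) auto
      then show ?thesis by (simp add: sum_distrib_left sum.distrib)
    qed
    moreover have "u *\<^sub>R x + w *\<^sub>R x' \<in> X"
      using \<open>convex X\<close> x x' u by (auto dest: convexD)
    ultimately show "u *\<^sub>R y + w *\<^sub>R z \<in> K"
      unfolding K_def by (auto intro!: bexI[of _ "u *\<^sub>R x + w *\<^sub>R x'"])
  qed
  have "?l \<notin> K" using neg unfolding K_def X_def by auto
  moreover have K0: "0 \<in> K" using X0 unfolding K_def by (auto intro!: bexI[of _ 0])
  ultimately obtain a b where a: "a \<noteq> 0" "\<And>z. z \<in> K \<Longrightarrow> a \<bullet> z \<le> b" "b \<le> a \<bullet> ?l"
    using separating_hyperplane_sets[of K "{?l}"] \<open>convex K\<close> by auto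
  have a_nonneg: "0 \<le> a $ j" for j
  proof (rule ccontr)
    assume j: "\<not> ?thesis"
    \<comment> \<open>Lowering coordinate \<open>j\<close> of 0 stays in \<open>K\<close>;
      \<open>N\<close> is the amount that raises the inner product with \<open>a\<close> to |b| + 1,
      beyond \<open>b\<close>.\<close>
    define N where "N = (\<bar>b\<bar> + 1) / (- a $ j)"
    have "0 \<le> N" unfolding N_def using j by (intro divide_nonneg_pos) auto
    then have "axis j (- N) \<in> K" using X0 unfolding K_def by (auto simp: axis_def intro!: bexI[of _ 0])
    then have "a $ j * (- N) \<le> b" using a(2)[of "axis j (- N)"] by (simp add: inner_axis)
    moreover have "a $ j * (- N) = \<bar>b\<bar> + 1" using j by (simp add: N_def)
    ultimately show False by simp
  qed
  define A where "A = (\<Sum>j\<in>UNIV. a $ j)"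
  have "0 < A"
  proof -
    obtain j where "a $ j \<noteq> 0" using a(1) by (auto simp: vec_eq_iff)
    then show ?thesis unfolding A_def
      using a_nonneg by (intro sum_pos2[of _ j]) (auto simp: less_le)
  qed
  have "\<exists>k. \<forall>j. a $ j / d $ i $ j \<le> a $ k / d $ i $ k" for i
    using ex_is_arg_min_if_finite[of UNIV "\<lambda>j. - (a $ j / d $ i $ j)"]
    by (auto simp: is_arg_min_linorder)
  then obtain k where k: "\<And>i j. a $ j / d $ i $ j \<le> a $ k i / d $ i $ k i" by metis
  \<comment> \<open>Each agent spends its whole bound \<open>c $ i\<close> on a chore maximizing
    \<open>a $ j / d $ i $ j\<close>; the column sums \<open>z\<close> then maximize the inner
    product with \<open>a\<close> over \<open>K\<close>.\<close>
  define x :: "real^'m^'n" where "x = (\<chi> i j. if j = k i then c $ i / d $ i $ k i else 0)"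
  define z :: "real^'m" where "z = (\<chi> j. \<Sum>i\<in>UNIV. x $ i $ j)"
  have "0 \<le> x $ i $ j" for i j using c[of i] d[of i] by (simp add: x_def less_imp_le)
  moreover have "(\<Sum>j\<in>UNIV. d $ i $ j * x $ i $ j) = c $ i" for i
    using d[of i "k i"] by (simp add: x_def if_distrib cong: if_cong)
  ultimately have "x \<in> X" by (simp add: X_def)
  then have "z \<in> K" unfolding K_def by (auto simp: z_def)
  then have "a \<bullet> z \<le> l * A"
    using a(2)[of z] a(3) by (simp add: A_def inner_vec_def sum_distrib_left mult.commute)
  have "a \<bullet> z = (\<Sum>j\<in>UNIV. \<Sum>i\<in>UNIV. a $ j * x $ i $ j)"
    by (simp add: inner_vec_def z_def sum_distrib_left)
  also have "\<dots> = (\<Sum>i\<in>UNIV. \<Sum>j\<in>UNIV. a $ j * x $ i $ j)" by (rule sum.swap)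
  also have "\<dots> = (\<Sum>i\<in>UNIV. c $ i * (a $ k i / d $ i $ k i))"
    by (intro sum.cong refl) (simp add: x_def if_distrib mult.commute cong: if_cong)
  finally have az: "a \<bullet> z = (\<Sum>i\<in>UNIV. c $ i * (a $ k i / d $ i $ k i))" .
  \<comment> \<open>The prices are \<open>a\<close> rescaled to total \<open>S\<close>; the
    coefficient of agent \<open>i\<close> is the least one feasible for them, the maximal ratio of
    price to disutility.\<close>
  have "v \<le> (\<Sum>i\<in>UNIV. c $ i * (\<chi> i. S / A * (a $ k i / d $ i $ k i)) $ i)"
  proof (rule primal)
    fix i j
    show "0 \<le> (\<chi> i. S / A * (a $ k i / d $ i $ k i)) $ i"
      using a_nonneg d S \<open>0 < A\<close> by (simp add: less_imp_le)
    show "0 \<le> ((S / A) *\<^sub>R a) $ j" using a_nonneg S \<open>0 < A\<close> by simp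
    have "a $ j \<le> a $ k i / d $ i $ k i * d $ i $ j"
      using k[of j i] d by (simp add: pos_divide_le_eq)
    then have "S / A * a $ j \<le> S / A * (a $ k i / d $ i $ k i * d $ i $ j)"
      using S \<open>0 < A\<close> by (intro mult_left_mono) auto
    then show "((S / A) *\<^sub>R a) $ j \<le> (\<chi> i. S / A * (a $ k i / d $ i $ k i)) $ i * d $ i $ j"
      by (simp add: mult.assoc)
  next
    show "(\<Sum>j\<in>UNIV. ((S / A) *\<^sub>R a) $ j) = S"
      using \<open>0 < A\<close> by (simp flip: sum_divide_distrib sum_distrib_left add: A_def)
  qed
  also have "\<dots> = S / A * (a \<bullet> z)"
    unfolding az by (simp add: sum_distrib_left mult_ac)
  also have "\<dots> \<le> S / A * (l * A)"
    using \<open>a \<bullet> z \<le> l * A\<close> S \<open>0 < A\<close> by (intro mult_left_mono) auto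
  also have "\<dots> = l * S" using \<open>0 < A\<close> by simp
  finally show False using l by simp
qed

section \<open>Feasible points and complementary slackness\<close>

text \<open>A zero entry would force every price to be at most 0, against their positive
  total.\<close>

lemma feasible_Y_pos:
  fixes d :: "real^'m^'n"
  assumes B: "\<forall>i. 0 < B $ i" and Y: "(b, q) \<in> feasible_Y d B"
  shows "0 < b $ i"
proof (rule ccontr)
  assume "\<not> ?thesis"
  with Y have "b $ i = 0" unfolding feasible_Y_def by (simp add: order_antisym)
  with Y have "q $ j \<le> 0" for j
    unfolding feasible_Y_def by (auto dest!: spec[of _ i])
  then have "(\<Sum>j\<in>UNIV. q $ j) \<le> 0" by (simp add: sum_nonpos)
  moreover have "0 < (\<Sum>i\<in>UNIV. B $ i)" using B by (intro sum_pos) auto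
  ultimately show False using Y by (simp add: feasible_Y_def)
qed

lemma gfw_lp_optimal_le:
  assumes "gfw_lp_optimal d B bp (b, q)" and "(b', q') \<in> feasible_Y d B"
  shows "(\<Sum>i\<in>UNIV. B $ i * (b $ i / bp $ i)) \<le> (\<Sum>i\<in>UNIV. B $ i * (b' $ i / bp $ i))"
proof -
  have "\<not> (\<Sum>i\<in>UNIV. B $ i * (b' $ i / bp $ i)) < (\<Sum>i\<in>UNIV. B $ i * (b $ i / bp $ i))"
    using assms unfolding gfw_lp_optimal_def is_arg_min_def by fastforce
  then show ?thesis by simp
qed

text \<open>Primal minus dual value is a sum of nonnegative slack products \<open>s1\<close>,
  \<open>s2\<close>, \<open>s3\<close>; strong duality makes this sum zero, so every product
  vanishes.\<close>

lemma gfw_complementary_slackness: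
  fixes d x :: "real^'m^'n" and B :: "real^'n"
  assumes d: "\<forall>i j. 0 < d $ i $ j" and B: "\<forall>i. 0 < B $ i" and prev: "\<forall>i. 0 < bp $ i"
    and opt: "gfw_lp_optimal d B bp (b, q)" and dual: "optimal_dual_variable d B bp x"
  defines "l \<equiv> (\<Sum>i\<in>UNIV. B $ i * (b $ i / bp $ i)) / (\<Sum>i\<in>UNIV. B $ i)"
  shows "x $ i $ j * q $ j = x $ i $ j * (d $ i $ j * b $ i)"
    and "(\<Sum>j\<in>UNIV. d $ i $ j * x $ i $ j) = B $ i / bp $ i"
    and "(\<Sum>i\<in>UNIV. x $ i $ j) = l"
proof -
  define S where "S = (\<Sum>i\<in>UNIV. B $ i)"
  define v where "v = (\<Sum>i\<in>UNIV. B $ i * (b $ i / bp $ i))"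
  have S: "0 < S" unfolding S_def using B by (intro sum_pos) auto
  have Y: "(b, q) \<in> feasible_Y d B"
    using opt by (simp add: gfw_lp_optimal_def is_arg_min_def)
  have b: "0 < b $ i" for i using feasible_Y_pos[OF B Y] .
  have q: "0 \<le> q $ j" "q $ j \<le> b $ i * d $ i $ j" "(\<Sum>j\<in>UNIV. q $ j) = S" for i j
    using Y by (auto simp: feasible_Y_def S_def)
  have v: "0 < v" unfolding v_def using B b prev by (intro sum_pos) auto
  obtain l' where arg: "is_arg_max (\<lambda>(x, l). l * S) (\<lambda>z. z \<in> dual_feasible d B bp) (x, l')"
    using dual by (auto simp: optimal_dual_variable_def S_def)
  then have "(x, l') \<in> dual_feasible d B bp" by (simp add: is_arg_max_def)
  then have x: "0 \<le> x $ i $ j" "l' \<le> (\<Sum>i\<in>UNIV. x $ i $ j)"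
    "(\<Sum>j\<in>UNIV. d $ i $ j * x $ i $ j) \<le> B $ i / bp $ i" for i j
    by (auto simp: dual_feasible_def)
  \<comment> \<open>Every \<open>w\<close> strictly below \<open>v / S\<close> is attained by a dual
    feasible point, so it is at most the optimal \<open>l'\<close>; density gives the bound
    itself.\<close>
  have "v / S \<le> l'"
  proof (rule dense_le)
    fix w assume "w < v / S"
    have "\<exists>y::real^'m^'n. (\<forall>i j. 0 \<le> y $ i $ j) \<and> (\<forall>j. w \<le> (\<Sum>i\<in>UNIV. y $ i $ j)) \<and>
         (\<forall>i. (\<Sum>j\<in>UNIV. d $ i $ j * y $ i $ j) \<le> (\<chi> i. B $ i / bp $ i) $ i)"
    proof (rule gfw_strong_duality[OF _ _ S])
      show "w * S < v" using \<open>w < v / S\<close> S by (simp add: field_simps)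
      fix b' :: "real^'n" and q' :: "real^'m"
      assume "\<And>i. 0 \<le> b' $ i" "\<And>j. 0 \<le> q' $ j" "\<And>i j. q' $ j \<le> b' $ i * d $ i $ j"
        "(\<Sum>j\<in>UNIV. q' $ j) = S"
      then have "(b', q') \<in> feasible_Y d B" by (simp add: feasible_Y_def S_def)
      then show "v \<le> (\<Sum>i\<in>UNIV. (\<chi> i. B $ i / bp $ i) $ i * b' $ i)"
        using gfw_lp_optimal_le[OF opt] by (simp add: v_def)
    qed (use d B prev in auto)
    then obtain y where "(y, w) \<in> dual_feasible d B bp" by (auto simp: dual_feasible_def)
    then show "w \<le> l'" using arg S by (force simp: is_arg_max_def not_less)
  qed
  then have gap: "v - l' * S \<le> 0" using S by (simp add: field_simps)
  define s1 where "s1 i = b $ i * (B $ i / bp $ i - (\<Sum>j\<in>UNIV. d $ i $ j * x $ i $ j))" for i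
  define s2 where "s2 i j = x $ i $ j * (d $ i $ j * b $ i - q $ j)" for i j
  define s3 where "s3 j = q $ j * ((\<Sum>i\<in>UNIV. x $ i $ j) - l')" for j
  have s: "0 \<le> s1 i" "0 \<le> s2 i j" "0 \<le> s3 j" for i j
    using x b q by (auto simp: s1_def s2_def s3_def less_imp_le mult.commute[of "d $ _ $ _"])
  have "sum s1 UNIV + (\<Sum>i\<in>UNIV. \<Sum>j\<in>UNIV. s2 i j) + sum s3 UNIV = v - l' * S"
  proof -
    have "(\<Sum>j\<in>UNIV. q $ j * (\<Sum>i\<in>UNIV. x $ i $ j)) = (\<Sum>i\<in>UNIV. \<Sum>j\<in>UNIV. x $ i $ j * q $ j)"
      by (subst sum.swap) (simp add: sum_distrib_left mult.commute)
    then have "sum s3 UNIV = (\<Sum>i\<in>UNIV. \<Sum>j\<in>UNIV. x $ i $ j * q $ j) - l' * S"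
      by (simp add: s3_def right_diff_distrib sum_subtractf q(3)[symmetric] sum_distrib_left mult.commute)
    moreover have "sum s1 UNIV = v - (\<Sum>i\<in>UNIV. \<Sum>j\<in>UNIV. x $ i $ j * (d $ i $ j * b $ i))"
      by (simp add: s1_def v_def right_diff_distrib sum_subtractf sum_distrib_left mult_ac)
    ultimately show ?thesis by (simp add: s2_def right_diff_distrib sum_subtractf)
  qed
  moreover have "0 \<le> sum s1 UNIV" "0 \<le> (\<Sum>i\<in>UNIV. \<Sum>j\<in>UNIV. s2 i j)" "0 \<le> sum s3 UNIV"
    using s by (auto intro!: sum_nonneg)
  ultimately have "sum s1 UNIV = 0" "(\<Sum>i\<in>UNIV. \<Sum>j\<in>UNIV. s2 i j) = 0" "sum s3 UNIV = 0"
    and l': "l' * S = v" using gap by linarith+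
  then have z: "s1 i = 0" "s2 i j = 0" "s3 j = 0" for i j
    using s by (simp_all add: sum_nonneg_eq_0_iff sum_nonneg)
  show tight: "x $ i $ j * q $ j = x $ i $ j * (d $ i $ j * b $ i)" for i j
    using z(2)[of i j] by (auto simp: s2_def)
  show "(\<Sum>j\<in>UNIV. d $ i $ j * x $ i $ j) = B $ i / bp $ i"
    using z(1)[of i] b[of i] by (simp add: s1_def)
  have l: "l' = l" using l' S by (simp add: l_def v_def S_def field_simps)
  \<comment> \<open>A zero price would empty column \<open>j\<close> by \<open>tight\<close>, making
    \<open>l'\<close> nonpositive although \<open>l' * S = v > 0\<close>. Hence
    \<open>s3 j = 0\<close> fixes the column sum.\<close>
  have "q $ j \<noteq> 0"
  proof
    assume "q $ j = 0"
    then have "x $ i $ j = 0" for i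
      using tight[of i j] d b[of i] by (metis less_irrefl mult_eq_0_iff mult_zero_right)
    then have "l' \<le> 0" using x(2)[of j] by simp
    with l' S v show False by (smt (verit) mult_nonpos_nonneg)
  qed
  then show "(\<Sum>i\<in>UNIV. x $ i $ j) = l" using z(3)[of j] l by (simp add: s3_def)
qed

section \<open>Approximate equilibrium from ratio bounds\<close>

text \<open>Earnings are \<open>B $ i\<close> times the ratio of agent \<open>i\<close>, and every
  column sum is the \<open>B\<close>-weighted mean of the ratios, so both inherit the bounds.
  Bundles are even exactly optimal.\<close>

lemma eps_CE_of_ratio_bounds:
  fixes d x :: "real^'m^'n" and B :: "real^'n"
  assumes d: "\<forall>i j. 0 < d $ i $ j" and B: "\<forall>i. 0 < B $ i" and \<epsilon>: "0 < \<epsilon>" "\<epsilon> < 1"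
    and prev: "\<forall>i. 0 < bp $ i"
    and opt: "gfw_lp_optimal d B bp (b, q)" and dual: "optimal_dual_variable d B bp x"
    and r: "\<And>i. 1 - \<epsilon> \<le> b $ i / bp $ i" "\<And>i. b $ i / bp $ i \<le> 1 / (1 - \<epsilon>)"
  shows "eps_CE d B \<epsilon> q x"
proof -
  note cs = gfw_complementary_slackness[OF d B prev opt dual]
  have Y: "(b, q) \<in> feasible_Y d B"
    using opt by (simp add: gfw_lp_optimal_def is_arg_min_def)
  have b: "0 < b $ i" for i using feasible_Y_pos[OF B Y] .
  have q: "0 \<le> q $ j" "q $ j \<le> b $ i * d $ i $ j" for i j
    using Y by (auto simp: feasible_Y_def)
  have x: "0 \<le> x $ i $ j" for i j
    using dual by (auto simp: optimal_dual_variable_def is_arg_max_def dual_feasible_def)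
  have px: "q \<bullet> x $ i = b $ i * (d $ i \<bullet> x $ i)" for i
  proof -
    have "q \<bullet> x $ i = (\<Sum>j\<in>UNIV. x $ i $ j * q $ j)" by (simp add: inner_vec_def mult.commute)
    also have "\<dots> = b $ i * (d $ i \<bullet> x $ i)"
      unfolding cs(1) by (simp add: inner_vec_def sum_distrib_left mult_ac)
    finally show ?thesis .
  qed
  have earn: "q \<bullet> x $ i = (b $ i / bp $ i) * B $ i" for i
    unfolding px using cs(2)[of i] by (simp add: inner_vec_def)
  have disutility: "(1 - \<epsilon>) * (d $ i \<bullet> x $ i) \<le> d $ i \<bullet> y"
    if y: "\<forall>j. 0 \<le> y $ j" "q \<bullet> x $ i \<le> q \<bullet> y" for i y
  proof -
    \<comment> \<open>Pay per unit of disutility is at most \<open>b $ i\<close> on every chore,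
      with equality on the chores used in \<open>x $ i\<close> by \<open>px\<close>.\<close>
    have "q \<bullet> y \<le> (\<Sum>j\<in>UNIV. (b $ i * d $ i $ j) * y $ j)"
      unfolding inner_vec_def using q y by (auto intro!: sum_mono mult_right_mono)
    also have "\<dots> = b $ i * (d $ i \<bullet> y)" by (simp add: inner_vec_def sum_distrib_left mult_ac)
    finally have "b $ i * (d $ i \<bullet> x $ i) \<le> b $ i * (d $ i \<bullet> y)" using y px[of i] by simp
    then have "d $ i \<bullet> x $ i \<le> d $ i \<bullet> y" using b[of i] by simp
    moreover have "0 \<le> d $ i \<bullet> x $ i"
      unfolding inner_vec_def using d x by (auto intro!: sum_nonneg simp: less_imp_le)
    then have "(1 - \<epsilon>) * (d $ i \<bullet> x $ i) \<le> d $ i \<bullet> x $ i"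
      using \<epsilon> by (simp add: mult_left_le_one_le)
    ultimately show ?thesis by simp
  qed
  have S: "0 < (\<Sum>i\<in>UNIV. B $ i)" using B by (intro sum_pos) auto
  have "(1 - \<epsilon>) * (\<Sum>i\<in>UNIV. B $ i) \<le> (\<Sum>i\<in>UNIV. B $ i * (b $ i / bp $ i))"
    unfolding sum_distrib_left
  proof (rule sum_mono)
    fix i show "(1 - \<epsilon>) * B $ i \<le> B $ i * (b $ i / bp $ i)"
      using mult_right_mono[OF r(1)[of i], of "B $ i"] B by (simp add: less_imp_le mult.commute)
  qed
  moreover have "(\<Sum>i\<in>UNIV. B $ i * (b $ i / bp $ i)) \<le> 1 / (1 - \<epsilon>) * (\<Sum>i\<in>UNIV. B $ i)"
    unfolding sum_distrib_left
  proof (rule sum_mono)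
    fix i show "B $ i * (b $ i / bp $ i) \<le> 1 / (1 - \<epsilon>) * B $ i"
      using mult_right_mono[OF r(2)[of i], of "B $ i"] B by (simp add: less_imp_le mult.commute)
  qed
  ultimately have "1 - \<epsilon> \<le> (\<Sum>i\<in>UNIV. x $ i $ j)" "(\<Sum>i\<in>UNIV. x $ i $ j) \<le> 1 / (1 - \<epsilon>)" for j
    unfolding cs(3) using S by (simp_all only: pos_le_divide_eq pos_divide_le_eq)
  then show ?thesis
    unfolding eps_CE_def earn
    using q x r B disutility earn by (auto intro!: mult_right_mono simp: less_imp_le simp del: times_divide_eq_left)
qed

section \<open>Progress per step and averaging\<close>

text \<open>The previous iterate is feasible, so the optimal value of the program is at most \<open>\<Sum> B\<^sub>i\<close>.\<close>

lemma gfw_step_increase: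
  fixes d :: "real^'m^'n" and B :: "real^'n"
  assumes B: "\<forall>i. 0 < B $ i" and prev: "(bp, qp) \<in> feasible_Y d B"
    and opt: "gfw_lp_optimal d B bp (b, q)"
  shows "(\<Sum>i\<in>UNIV. B $ i * (b $ i / bp $ i - 1 - ln (b $ i / bp $ i)))
           \<le> log_obj B b - log_obj B bp"
proof -
  have Y: "(b, q) \<in> feasible_Y d B"
    using opt by (simp add: gfw_lp_optimal_def is_arg_min_def)
  have pos: "0 < b $ i" "0 < bp $ i" for i
    using feasible_Y_pos[OF B Y] feasible_Y_pos[OF B prev] by auto
  have "(\<Sum>i\<in>UNIV. B $ i * (b $ i / bp $ i)) \<le> (\<Sum>i\<in>UNIV. B $ i * (bp $ i / bp $ i))"
    by (rule gfw_lp_optimal_le[OF opt prev])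
  also have "\<dots> = (\<Sum>i\<in>UNIV. B $ i)" using pos by (simp add: less_imp_neq[symmetric])
  finally have "(\<Sum>i\<in>UNIV. B $ i * (b $ i / bp $ i)) \<le> (\<Sum>i\<in>UNIV. B $ i)" .
  \<comment> \<open>The logarithms add up to the increase of the objective; the other terms are
    nonpositive by the preceding bound.\<close>
  moreover have "(\<Sum>i\<in>UNIV. B $ i * (b $ i / bp $ i - 1 - ln (b $ i / bp $ i))) =
      (\<Sum>i\<in>UNIV. B $ i * (b $ i / bp $ i)) - (\<Sum>i\<in>UNIV. B $ i)
        + (log_obj B b - log_obj B bp)"
    using pos[THEN less_imp_neq, THEN not_sym]
    by (simp add: log_obj_def ln_div right_diff_distrib sum_subtractf)
  ultimately show ?thesis by simp
qed

theorem theorem8: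
  fixes d :: "real^'m^'n" and B :: "real^'n" and \<epsilon> :: real
    and \<beta> :: "nat \<Rightarrow> real^'n" and p :: "nat \<Rightarrow> real^'m" and x :: "nat \<Rightarrow> real^'m^'n"
    and \<beta>star :: "real^'n" and pstar :: "real^'m" and T :: nat
  assumes "\<forall>i j. 0 < d $ i $ j"
    and "\<forall>i. 0 < B $ i"
    and "0 < \<epsilon>" and "\<epsilon> < 1"
    and "gfw_sequence d B \<beta> p"
    and "\<forall>t\<ge>1. optimal_dual_variable d B (\<beta> (t - 1)) (x t)"
    and "is_arg_max (\<lambda>(\<beta>, p). log_obj B \<beta>) (\<lambda>z. z \<in> feasible_Y d B) (\<beta>star, pstar)"
    and "T \<ge> 1"
    and "real T \<ge> 2.3 * (log_obj B \<beta>star - log_obj B (\<beta> 0)) / (\<epsilon>\<^sup>2 * (MIN i. B $ i))"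
  shows "\<exists>t. 1 \<le> t \<and> t \<le> T \<and> eps_CE d B \<epsilon> (p t) (x t)"
proof -
  note B = assms(2)
  define M where "M = (MIN i. B $ i)"
  have "M \<in> range (($) B)" unfolding M_def by (intro Min_in) auto
  then have M: "0 < M" using B by auto
  have M_le: "M \<le> B $ i" for i unfolding M_def by (intro Min_le) auto
  have opt: "gfw_lp_optimal d B (\<beta> t) (\<beta> (Suc t), p (Suc t))" for t
    using assms(5) by (auto simp: gfw_sequence_def dest!: spec[of _ "Suc t"])
  have Y: "(\<beta> t, p t) \<in> feasible_Y d B" for t
  proof (cases t)
    case 0
    then show ?thesis using assms(5) by (simp add: gfw_sequence_def)
  next
    case (Suc s)
    then show ?thesis using opt[of s] by (simp add: gfw_lp_optimal_def is_arg_min_def)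
  qed
  have pos: "0 < \<beta> t $ i" for t i using feasible_Y_pos[OF B Y] .
  \<comment> \<open>Index \<open>t\<close> belongs to iteration \<open>Suc t\<close>, so
    \<open>t < T\<close> covers exactly the iterations 1 to \<open>T\<close>.\<close>
  define r where "r t i = \<beta> (Suc t) $ i / \<beta> t $ i" for t i
  have r: "0 < r t i" for t i using pos by (simp add: r_def)
  have nonneg: "0 \<le> r t i - 1 - ln (r t i)" for t i
    using ln_le_minus_one[OF r] by simp
  define g where "g t = (\<Sum>i\<in>UNIV. B $ i * (r t i - 1 - ln (r t i)))" for t
  have "(\<Sum>t<T. g t) \<le> (\<Sum>t<T. log_obj B (\<beta> (Suc t)) - log_obj B (\<beta> t))"
    unfolding g_def r_def by (intro sum_mono gfw_step_increase[OF B Y opt])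
  also have "\<dots> = log_obj B (\<beta> T) - log_obj B (\<beta> 0)" by (rule sum_lessThan_telescope)
  also have "\<dots> \<le> log_obj B \<beta>star - log_obj B (\<beta> 0)"
    using assms(7) Y[of T] by (force simp: is_arg_max_def not_less)
  also have "\<dots> \<le> real T * (\<epsilon>\<^sup>2 * M / 2.3)"
    using assms(3,9) M by (simp add: M_def[symmetric] pos_divide_le_eq)
  finally have total: "(\<Sum>t<T. g t) \<le> real T * (\<epsilon>\<^sup>2 * M / 2.3)" .
  \<comment> \<open>Averaging: the smallest of the \<open>T\<close> increments is at most their
    mean.\<close>
  have "\<exists>t<T. g t \<le> \<epsilon>\<^sup>2 * M / 2.3"
  proof (rule ccontr)
    assume "\<not> ?thesis"
    then have "(\<Sum>t<T. \<epsilon>\<^sup>2 * M / 2.3) < (\<Sum>t<T. g t)"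
      using assms(8) by (intro sum_strict_mono) (auto simp: not_le lessThan_empty_iff)
    with total show False by simp
  qed
  then obtain t where t: "t < T" "g t \<le> \<epsilon>\<^sup>2 * M / 2.3" by blast
  have gap: "r t i - 1 - ln (r t i) \<le> \<epsilon>\<^sup>2 / 2" for i
  proof -
    have "M * (r t i - 1 - ln (r t i)) \<le> B $ i * (r t i - 1 - ln (r t i))"
      using M_le nonneg by (intro mult_right_mono)
    also have "\<dots> \<le> g t"
      unfolding g_def using nonneg B by (intro member_le_sum) (auto simp: less_imp_le)
    also have "\<dots> \<le> \<epsilon>\<^sup>2 * M / 2.3" by (rule t(2))
    \<comment> \<open>The constant enters here, through 2.3 being at least 2.\<close>
    also have "\<dots> \<le> M * (\<epsilon>\<^sup>2 / 2)" using M by (simp add: field_simps)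
    finally show ?thesis using M by simp
  qed
  have "eps_CE d B \<epsilon> (p (Suc t)) (x (Suc t))"
  proof (rule eps_CE_of_ratio_bounds[OF assms(1) B assms(3,4) _ opt])
    show "optimal_dual_variable d B (\<beta> t) (x (Suc t))" using assms(6) by force
  qed (use pos ratio_bounds_of_log_gap[OF r assms(3,4) gap] in \<open>auto simp: r_def\<close>)
  then show ?thesis using t(1) by (intro exI[of _ "Suc t"]) auto
qed

end
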